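(* Let $1\le k<n$, let $X=\{x_1,\dots,x_n\}$ and $y$ be propositional variables, and let $\Phi_{SN}^{n,k}(X;Z)$ be the Horn CNF formula encoding a sorting network with inputs $X$ and outputs $Z=\{z_1,\dots,z_n\}$ (sorted in descending order), $y$ not occurring in it. The encoding $$\Phi_{SN}^{n,k}(X;Z)\wedge(\neg y\vee\neg z_{k+1})$$ preserves the generalized arc consistency (by unit propagation) of $y\rightarrow\sum_{i=1}^n x_i\le k$.
   Context: Sorting network formula. A comparator with input variables $a,b$ and output variables $c,d$ is encoded by the Horn clauses $a\rightarrow c$, $b\rightarrow c$, $a\wedge b\rightarrow d$, i.e. $(\neg a\vee c)\wedge(\neg b\vee c)\wedge(\neg a\vee\neg b\vee d)$; the intended meaning is $c=\max(a,b)$, $d=\min(a,b)$. A sorting network on $n$ inputs is a circuit on $n$ wires composed of comparators only (each applied to the current values on two wires and replacing them by their maximum and minimum), such that for every Boolean input $(x_1,\dots,x_n)$ the outputs $z_1,\dots,z_n$ form the inputs sorted in descending order ($z_1\ge z_2\ge\dots\ge z_n$). $\Phi_{SN}^{n,k}(X;Z)$ is the conjunction of the clauses of all comparators of such a network, with fresh variables for the two outputs of each comparator; $Z$ names the variables on the final wires. Unit propagation on a CNF formula repeatedly picks a unit clause $\{l\}$, deletes all clauses containing $l$ and removes the complement of $l$ from the other clauses; a literal is derived by unit propagation if it occurs as a unit clause at some stage, and a conflict is derived if the empty clause appears. For a set of literals $\rho$, unit propagation on $\mathcal F$ under $\rho$ means unit propagation on $\mathcal F\wedge\bigwedge_{l\in\rho}l$.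 A partial assignment of $x_1,\dots,x_n$ is a set of literals over these variables containing no complementary pair. A CNF formula $\mathcal F$ over $y,x_1,\dots,x_n$ and auxiliary variables preserves the generalized arc consistency (GAC) of $y\rightarrow\sum_{i=1}^n x_i\le k$ if for every partial assignment $\rho$ of $x_1,\dots,x_n$: (i) (when $y$ is true, GAC is maintained on the cardinality constraint) under $\rho\cup\{y\}$: if more than $k$ of the $x_i$ are true in $\rho$, unit propagation on $\mathcal F$ derives a conflict; and if exactly $k$ of the $x_i$ are true in $\rho$, unit propagation derives $\neg x_j$ for every $x_j$ not assigned by $\rho$; (ii) if more than $k$ of the $x_i$ are true in $\rho$ (the cardinality constraint is false), unit propagation on $\mathcal F$ under $\rho$ derives $\neg y$. *)

theory Defs
  imports Main
begin

section \<open>CNF formulas and unit propagation\<close>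

datatype 'v literal = Pos (var: 'v) | Neg (var: 'v)

fun compl :: "'v literal \<Rightarrow> 'v literal" where
  "compl (Pos v) = Neg v"
| "compl (Neg v) = Pos v"

type_synonym 'v clause = "'v literal set"
type_synonym 'v cnf = "'v clause set"

definition cnf_vars :: "'v cnf \<Rightarrow> 'v set" where
  "cnf_vars F = var ` \<Union> F"

text \<open>
  The picked unit clause is itself among the deleted clauses. The empty clause is never deleted.
\<close>

inductive up_step :: "'v cnf \<Rightarrow> 'v cnf \<Rightarrow> bool" where
  "{l} \<in> F \<Longrightarrow> up_step F {C - {compl l} | C. C \<in> F \<and> l \<notin> C}"

definition up_derives :: "'v cnf \<Rightarrow> 'v literal \<Rightarrow> bool" where
  "up_derives F l \<longleftrightarrow> (\<exists>G. up_step\<^sup>*\<^sup>* F G \<and> {l} \<in> G)"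

definition up_conflict :: "'v cnf \<Rightarrow> bool" where
  "up_conflict F \<longleftrightarrow> (\<exists>G. up_step\<^sup>*\<^sup>* F G \<and> {} \<in> G)"

definition under :: "'v cnf \<Rightarrow> 'v literal set \<Rightarrow> 'v cnf" where
  "under F \<rho> = F \<union> {{l} | l. l \<in> \<rho>}"


section \<open>Generalized arc consistency\<close>

definition partial_assignment :: "'v set \<Rightarrow> 'v literal set \<Rightarrow> bool" where
  "partial_assignment X \<rho> \<longleftrightarrow> var ` \<rho> \<subseteq> X \<and> (\<forall>l\<in>\<rho>. compl l \<notin> \<rho>)"

definition num_true :: "nat \<Rightarrow> (nat \<Rightarrow> 'v) \<Rightarrow> 'v literal set \<Rightarrow> nat" where
  "num_true n x \<rho> = card {i \<in> {1..n}. Pos (x i) \<in> \<rho>}"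

text \<open>
  \<open>F\<close> preserves GAC of the implication from \<open>y\<close> to the cardinality constraint
  stating that at most \<open>k\<close> of \<open>x 1, \<dots>, x n\<close> are true.
\<close>

definition preserves_GAC ::
  "'v cnf \<Rightarrow> 'v \<Rightarrow> nat \<Rightarrow> (nat \<Rightarrow> 'v) \<Rightarrow> nat \<Rightarrow> bool" where
  "preserves_GAC F y n x k \<longleftrightarrow>
    (\<forall>\<rho>. partial_assignment (x ` {1..n}) \<rho> \<longrightarrow>
      (num_true n x \<rho> > k \<longrightarrow> up_conflict (under F (\<rho> \<union> {Pos y}))) \<and>
      (num_true n x \<rho> = k \<longrightarrow>
        (\<forall>j\<in>{1..n}. Pos (x j) \<notin> \<rho> \<and> Neg (x j) \<notin> \<rho> \<longrightarrow>
          up_derives (under F (\<rho> \<union> {Pos y})) (Neg (x j)))) \<and>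
      (num_true n x \<rho> > k \<longrightarrow> up_derives (under F \<rho>) (Neg y)))"


section \<open>Sorting networks and their Horn encoding\<close>

text \<open>
  \<open>Comparator i j c d\<close> reads wires \<open>i\<close> and \<open>j\<close>, puts the maximum on wire \<open>i\<close> and the
  minimum on wire \<open>j\<close>; \<open>i < j\<close> is not required. The propositional variables \<open>c\<close> and \<open>d\<close>
  name these two outputs in the CNF encoding and play no role in the evaluation.
\<close>

datatype 'v comparator =
  Comparator (max_wire: nat) (min_wire: nat) (max_var: 'v) (min_var: 'v)

fun network_eval :: "(nat \<Rightarrow> bool) \<Rightarrow> 'v comparator list \<Rightarrow> nat \<Rightarrow> bool" where
  "network_eval b [] = b"
| "network_eval b (Comparator i j c d # N) =
     network_eval (b(i := max (b i) (b j), j := min (b i) (b j))) N"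

definition sorting_network :: "nat \<Rightarrow> 'v comparator list \<Rightarrow> bool" where
  "sorting_network n N \<longleftrightarrow>
    (\<forall>g \<in> set N. max_wire g \<in> {1..n} \<and> min_wire g \<in> {1..n} \<and> max_wire g \<noteq> min_wire g) \<and>
    (\<forall>b. map (network_eval b N) [1..<Suc n] = rev (sort (map b [1..<Suc n])))"

definition comparator_clauses :: "'v \<Rightarrow> 'v \<Rightarrow> 'v \<Rightarrow> 'v \<Rightarrow> 'v cnf" where
  "comparator_clauses a b c d = {{Neg a, Pos c}, {Neg b, Pos c}, {Neg a, Neg b, Pos d}}"

text \<open>The first argument maps each wire to the variable currently on it.\<close>

fun network_cnf :: "(nat \<Rightarrow> 'v) \<Rightarrow> 'v comparator list \<Rightarrow> 'v cnf" where
  "network_cnf w [] = {}"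
| "network_cnf w (Comparator i j c d # N) =
     comparator_clauses (w i) (w j) c d \<union> network_cnf (w(i := c, j := d)) N"

fun network_outputs :: "(nat \<Rightarrow> 'v) \<Rightarrow> 'v comparator list \<Rightarrow> nat \<Rightarrow> 'v" where
  "network_outputs w [] = w"
| "network_outputs w (Comparator i j c d # N) = network_outputs (w(i := c, j := d)) N"

definition fresh_outputs :: "'v set \<Rightarrow> 'v comparator list \<Rightarrow> bool" where
  "fresh_outputs X N \<longleftrightarrow>
    (let vs = concat (map (\<lambda>g. [max_var g, min_var g]) N) in distinct vs \<and> set vs \<inter> X = {})"

definition SN_encoding :: "nat \<Rightarrow> (nat \<Rightarrow> 'v) \<Rightarrow> 'v cnf \<Rightarrow> (nat \<Rightarrow> 'v) \<Rightarrow> bool" where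
  "SN_encoding n x \<Phi> z \<longleftrightarrow>
    (\<exists>N. sorting_network n N \<and> fresh_outputs (x ` {1..n}) N \<and>
         \<Phi> = network_cnf x N \<and> (\<forall>i\<in>{1..n}. z i = network_outputs x N i))"

end

theory Submission
  imports Defs "HOL-Library.Multiset"
begin

text \<open>
  Unit propagation is only ever run along literals that are true in a fixed valuation \<open>v\<close> (the
  values computed by the network on the input whose true variables are those asserted by \<open>\<rho>\<close>),
  so no propagated literal can destroy a clause that is needed later.

  Forward propagation through the comparators derives every variable that is true in \<open>v\<close>, in
  particular \<open>z (k + 1)\<close> if more than \<open>k\<close> inputs are true. If exactly \<open>k\<close> inputs are true, then
  switching on one further input \<open>x p\<close> changes exactly one wire after each comparator and, finally,
  the output \<open>z (k + 1)\<close>; the negation of \<open>z (k + 1)\<close> is propagated backwards along these wires.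
\<close>

section \<open>Unit propagation along a valuation\<close>

definition lit_true :: "('v \<Rightarrow> bool) \<Rightarrow> 'v literal \<Rightarrow> bool" where
  "lit_true v l \<longleftrightarrow> (case l of Pos u \<Rightarrow> v u | Neg u \<Rightarrow> \<not> v u)"

lemma lit_true_simps [simp]:
  "lit_true v (Pos u) \<longleftrightarrow> v u"
  "lit_true v (Neg u) \<longleftrightarrow> \<not> v u"
  by (simp_all add: lit_true_def)

lemma compl_compl [simp]: "compl (compl l) = l"
  by (cases l) simp_all

lemma lit_true_compl [simp]: "lit_true v (compl l) \<longleftrightarrow> \<not> lit_true v l"
  by (cases l) simp_all

lemma in_compl_image_iff: "l \<in> compl ` S \<longleftrightarrow> compl l \<in> S"
  by (metis compl_compl image_iff)

lemma compl_image_disjoint: "\<forall>l\<in>S. lit_true v l \<Longrightarrow> compl ` S \<inter> S = {}"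
  using lit_true_compl by fastforce

text \<open>The premises refer to clauses of the original \<open>F\<close>, so a derivation need not
  track which clauses have been deleted or shortened; truth under \<open>v\<close> keeps
  \<open>S\<close> consistent.\<close>

inductive up_along :: "('v \<Rightarrow> bool) \<Rightarrow> 'v cnf \<Rightarrow> 'v literal set \<Rightarrow> bool"
  for v F where
  empty: "up_along v F {}"
| insert: "up_along v F S \<Longrightarrow> C \<in> F \<Longrightarrow> l \<in> C \<Longrightarrow> C - {l} \<subseteq> compl ` S \<Longrightarrow> lit_true v l
    \<Longrightarrow> up_along v F (insert l S)"

text \<open>The formula reached by unit propagation once exactly the literals of \<open>S\<close>
  have been picked, in whatever order.\<close>

definition residual :: "'v cnf \<Rightarrow> 'v literal set \<Rightarrow> 'v cnf" where
  "residual F S = {C - compl ` S | C. C \<in> F \<and> C \<inter> S = {}}"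

lemma up_along_lit_true: "up_along v F S \<Longrightarrow> l \<in> S \<Longrightarrow> lit_true v l"
  by (induction rule: up_along.induct) auto

text \<open>If \<open>C\<close> met \<open>S\<close>, the common literal would differ from
  \<open>l\<close>, so its complement would lie in \<open>S\<close> too, which \<open>v\<close>
  forbids. So \<open>C\<close> survives, and \<open>l\<close> alone is not stripped from it.\<close>

lemma unit_in_residual:
  assumes "\<forall>l\<in>S. lit_true v l" "C \<in> F" "l \<in> C" "C - {l} \<subseteq> compl ` S" "lit_true v l" "l \<notin> S"
  shows "{l} \<in> residual F S"
proof -
  have "C \<inter> S = {}"
  proof (intro equals0I)
    fix m assume "m \<in> C \<inter> S"
    then have "m \<in> S" "compl m \<in> S"
      using assms(4,6) in_compl_image_iff[of m S] by blast+
    then show False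
      using assms(1) lit_true_compl by blast
  qed
  moreover have "compl l \<notin> S"
    using assms(1,5) lit_true_compl by blast
  then have "C - compl ` S = {l}"
    using assms(3,4) in_compl_image_iff[of l S] by blast
  ultimately show ?thesis
    using assms(2) unfolding residual_def mem_Collect_eq by metis
qed

text \<open>The step deletes clauses in which \<open>l\<close> still occurs, the new residual those
  in which \<open>l\<close> occurred originally. These agree because \<open>compl l\<close> is false
  under \<open>v\<close>, hence not in \<open>S\<close>, so \<open>l\<close> was never stripped from
  a clause.\<close>

lemma up_step_residual:
  assumes "\<forall>l\<in>S. lit_true v l" "{l} \<in> residual F S" "lit_true v l"
  shows "up_step (residual F S) (residual F (insert l S))"
proof -
  have *: "compl l \<notin> S"
    using assms by auto
  have "residual F (insert l S) = {C - {compl l} | C. C \<in> residual F S \<and> l \<notin> C}"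
  proof (intro set_eqI iffI)
    fix D assume "D \<in> residual F (insert l S)"
    then obtain C where "C \<in> F" "C \<inter> insert l S = {}" "D = C - compl ` insert l S"
      unfolding residual_def by blast
    then have "C - compl ` S \<in> residual F S" "l \<notin> C - compl ` S" "D = (C - compl ` S) - {compl l}"
      unfolding residual_def by auto
    then show "D \<in> {C - {compl l} | C. C \<in> residual F S \<and> l \<notin> C}"
      by blast
  next
    fix D assume "D \<in> {C - {compl l} | C. C \<in> residual F S \<and> l \<notin> C}"
    then obtain C where "C \<in> F" "C \<inter> S = {}" "l \<notin> C - compl ` S" "D = (C - compl ` S) - {compl l}"
      unfolding residual_def by blast
    moreover from this * have "C \<inter> insert l S = {}"
      by (auto simp: in_compl_image_iff)
    moreover have "(C - compl ` S) - {compl l} = C - compl ` insert l S"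
      by auto
    ultimately show "D \<in> residual F (insert l S)"
      unfolding residual_def by blast
  qed
  then show ?thesis
    using up_step.intros[OF assms(2)] by simp
qed

lemma up_along_up_steps: "up_along v F S \<Longrightarrow> up_step\<^sup>*\<^sup>* F (residual F S)"
proof (induction rule: up_along.induct)
  case empty
  then show ?case by (simp add: residual_def)
next
  case (insert S C l)
  \<comment> \<open>If \<open>l\<close> is already in \<open>S\<close>, nothing changes and no step
    is taken.\<close>
  then show ?case
    using up_step_residual unit_in_residual up_along_lit_true
    by (metis insert_absorb rtranclp.rtrancl_into_rtrancl)
qed

text \<open>Picking \<open>l\<close> deletes \<open>{l}\<close> itself, so the witness is not the
  final residual but the one just before \<open>l\<close> enters \<open>S\<close>.\<close>

lemma up_along_derives: "up_along v F S \<Longrightarrow> l \<in> S \<Longrightarrow> up_derives F l"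
proof (induction rule: up_along.induct)
  case empty
  then show ?case by simp
next
  case (insert S C m)
  show ?case
  proof (cases "l \<in> S")
    case False
    then have "{l} \<in> residual F S"
      using insert by (intro unit_in_residual[of S v C]) (auto intro: up_along_lit_true)
    then show ?thesis
      using up_along_up_steps[OF insert.hyps(1)] unfolding up_derives_def by blast
  qed (use insert.IH in blast)
qed

text \<open>Since \<open>v\<close> satisfies \<open>S\<close>, no literal of \<open>C\<close> lies
  in \<open>S\<close>: \<open>C\<close> is not deleted and all its literals are stripped.\<close>

lemma up_along_conflict:
  assumes "up_along v F S" "C \<in> F" "C \<subseteq> compl ` S"
  shows "up_conflict F"
proof -
  have "C \<inter> S = {}"
    using compl_image_disjoint[of S v] up_along_lit_true[OF assms(1)] assms(3) by fast
  then have "{} \<in> residual F S"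
    using assms(2,3) unfolding residual_def by blast
  then show ?thesis
    using up_along_up_steps[OF assms(1)] unfolding up_conflict_def by blast
qed

lemma up_along_units:
  assumes "finite T" "up_along v F S" "\<forall>l\<in>T. {l} \<in> F \<and> lit_true v l"
  shows "up_along v F (T \<union> S)"
  using assms(1,3)
proof (induction T rule: finite_induct)
  case (insert l T)
  then show ?case
    using up_along.insert[of v F "T \<union> S" "{l}" l] by simp
qed (use assms(2) in simp)


section \<open>Propagation through a network\<close>

text \<open>The part of \<open>sorting_network\<close> that passes to suffixes of the list, as
  induction over the comparators requires.\<close>

definition wires_in :: "nat set \<Rightarrow> 'v comparator list \<Rightarrow> bool" where
  "wires_in I N \<longleftrightarrow> (\<forall>g\<in>set N. max_wire g \<in> I \<and> min_wire g \<in> I \<and> max_wire g \<noteq> min_wire g)"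

definition output_vars :: "'v comparator list \<Rightarrow> 'v set" where
  "output_vars N = set (concat (map (\<lambda>g. [max_var g, min_var g]) N))"

text \<open>Equivalences, whereas the Horn clauses only give implications from inputs to outputs:
  \<open>v\<close> is the actual computation of the network.\<close>

fun network_model :: "('v \<Rightarrow> bool) \<Rightarrow> (nat \<Rightarrow> 'v) \<Rightarrow> 'v comparator list \<Rightarrow> bool" where
  "network_model v w [] \<longleftrightarrow> True"
| "network_model v w (Comparator i j c d # N) \<longleftrightarrow>
     v c = (v (w i) \<or> v (w j)) \<and> v d = (v (w i) \<and> v (w j)) \<and> network_model v (w(i := c, j := d)) N"

lemma wires_in_simps [simp]:
  "wires_in I []"
  "wires_in I (Comparator i j c d # N) \<longleftrightarrow> i \<in> I \<and> j \<in> I \<and> i \<noteq> j \<and> wires_in I N"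
  by (auto simp: wires_in_def)

lemma output_vars_simps [simp]:
  "output_vars [] = {}"
  "output_vars (Comparator i j c d # N) = insert c (insert d (output_vars N))"
  by (auto simp: output_vars_def)

lemma max_bool [simp]: "max (a::bool) b = (a \<or> b)"
  by (auto simp: max_def)

lemma min_bool [simp]: "min (a::bool) b = (a \<and> b)"
  by (auto simp: min_def)

lemma network_induct [case_names Nil Cons]:
  assumes "\<And>w. P w []"
    and "\<And>w i j c d N. P (w(i := c, j := d)) N \<Longrightarrow> P w (Comparator i j c d # N)"
  shows "P w N"
proof (induction N arbitrary: w)
  case (Cons g N)
  then show ?case
    using assms(2) by (cases g) blast
qed (fact assms(1))

text \<open>Shows that \<open>y\<close>, absent from the formula, is no comparator output, so that
  \<open>v y\<close> can be chosen freely.\<close>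

lemma output_vars_subset_cnf_vars: "output_vars N \<subseteq> cnf_vars (network_cnf w N)"
proof (induction w N rule: network_induct)
  case (Cons w i j c d N)
  then show ?case
    by (auto simp: cnf_vars_def comparator_clauses_def image_Un simp del: fun_upd_apply)
qed simp

lemma network_outputs_in:
  "wires_in I N \<Longrightarrow> i \<in> I \<Longrightarrow> network_outputs w N i \<in> w ` I \<union> output_vars N"
proof (induction w N rule: network_induct)
  case (Cons w a b c d N)
  then have "network_outputs (w(a := c, b := d)) N i \<in> (w(a := c, b := d)) ` I \<union> output_vars N"
    by (simp del: fun_upd_apply)
  moreover have "(w(a := c, b := d)) ` I \<subseteq> insert c (insert d (w ` I))"
    by auto
  ultimately show ?case by (auto simp del: fun_upd_apply)
qed simp

lemma network_eval_model:
  "network_model v w N \<Longrightarrow> network_eval (v \<circ> w) N = v \<circ> network_outputs w N"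
proof (induction w N rule: network_induct)
  case (Cons w i j c d N)
  then have "(v \<circ> w)(i := (v \<circ> w) i \<or> (v \<circ> w) j, j := (v \<circ> w) i \<and> (v \<circ> w) j) =
      v \<circ> (w(i := c, j := d))"
    by (simp add: fun_eq_iff)
  moreover have "network_eval (v \<circ> (w(i := c, j := d))) N = v \<circ> network_outputs (w(i := c, j := d)) N"
    using Cons by (simp only: network_model.simps)
  ultimately show ?case
    unfolding network_eval.simps network_outputs.simps max_bool min_bool by (simp only:)
qed simp

text \<open>Values are assigned comparator by comparator; freshness ensures that no output
  overwrites an earlier value. The background \<open>v\<close> supplies the inputs and all other
  variables, such as \<open>y\<close>.\<close>

lemma ex_network_model:
  assumes "wires_in I N" "fresh_outputs X N" "w ` I \<subseteq> X"
  shows "\<exists>v'. network_model v' w N \<and> (\<forall>u. u \<notin> output_vars N \<longrightarrow> v' u = v u)"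
  using assms
proof (induction w N arbitrary: X v rule: network_induct)
  case (Cons w i j c d N)
  let ?v = "v(c := v (w i) \<or> v (w j), d := v (w i) \<and> v (w j))"
  have fresh: "c \<noteq> d" "{c, d} \<inter> X = {}" "output_vars N \<inter> (X \<union> {c, d}) = {}"
    and "fresh_outputs (X \<union> {c, d}) N"
    using Cons(3) by (auto simp: fresh_outputs_def output_vars_def Let_def)
  moreover have "(w(i := c, j := d)) ` I \<subseteq> X \<union> {c, d}"
    using Cons(4) by auto
  \<comment> \<open>Behind the comparator \<open>c\<close> and \<open>d\<close> are on wires, so the
    induction hypothesis is used with both added to the forbidden set \<open>X\<close>.\<close>
  ultimately obtain v' where v': "network_model v' (w(i := c, j := d)) N"
      "\<And>u. u \<notin> output_vars N \<Longrightarrow> v' u = ?v u"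
    using Cons(1)[of "X \<union> {c, d}" ?v] Cons(2) by (metis wires_in_simps(2))
  have "w i \<in> X" "w j \<in> X"
    using Cons(2,4) by auto
  then have "w i \<notin> output_vars N" "w j \<notin> output_vars N" "w i \<notin> {c, d}" "w j \<notin> {c, d}"
    using fresh by blast+
  then have "v' (w i) = v (w i)" "v' (w j) = v (w j)"
    using v'(2) by simp_all
  moreover have "v' c = (v (w i) \<or> v (w j))" "v' d = (v (w i) \<and> v (w j))"
    using fresh v'(2) by auto
  ultimately show ?case
    using v' by (intro exI[of _ v']) auto
qed auto

text \<open>A true maximum has a true input, which reduces one of the two-literal clauses to
  \<open>Pos c\<close>; a true minimum has two true inputs, which reduce the third clause to
  \<open>Pos d\<close>.\<close>

lemma forward_propagation:
  assumes "wires_in I N" "network_model v w N" "network_cnf w N \<subseteq> F" "up_along v F S"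
    and "\<forall>u \<in> w ` I. v u \<longrightarrow> Pos u \<in> S"
  shows "\<exists>S'. S \<subseteq> S' \<and> up_along v F S' \<and> (\<forall>u \<in> w ` I \<union> output_vars N. v u \<longrightarrow> Pos u \<in> S')"
  using assms
proof (induction w N arbitrary: S rule: network_induct)
  case (Cons w i j c d N)
  have clauses: "{Neg (w i), Pos c} \<in> F" "{Neg (w j), Pos c} \<in> F" "{Neg (w i), Neg (w j), Pos d} \<in> F"
    using Cons(4) by (auto simp: comparator_clauses_def)
  have vals: "v c = (v (w i) \<or> v (w j))" "v d = (v (w i) \<and> v (w j))"
    using Cons(3) by auto
  have ins: "v (w i) \<Longrightarrow> Pos (w i) \<in> S" "v (w j) \<Longrightarrow> Pos (w j) \<in> S"
    using Cons(2,6) by auto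
  have "\<exists>S1. S \<subseteq> S1 \<and> up_along v F S1 \<and> (v c \<longrightarrow> Pos c \<in> S1)"
  proof (cases "v c")
    case True
    then consider "v (w i)" | "v (w j)" using vals by auto
    then have "up_along v F (insert (Pos c) S)"
    proof cases
      case 1
      then show ?thesis
        using clauses(1) ins True by (intro up_along.insert[OF Cons(5)]) (auto simp: in_compl_image_iff)
    next
      case 2
      then show ?thesis
        using clauses(2) ins True
        by (intro up_along.insert[OF \<open>up_along v F S\<close>]) (auto simp: in_compl_image_iff)
    qed
    then show ?thesis by blast
  qed (use Cons(5) in blast)
  then obtain S1 where S1: "S \<subseteq> S1" "up_along v F S1" "v c \<longrightarrow> Pos c \<in> S1"
    by blast
  have "\<exists>S2. S1 \<subseteq> S2 \<and> up_along v F S2 \<and> (v d \<longrightarrow> Pos d \<in> S2)"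
  proof (cases "v d")
    case True
    then have "up_along v F (insert (Pos d) S1)"
      using clauses(3) ins S1(1) vals
      by (intro up_along.insert[OF S1(2)]) (auto simp: in_compl_image_iff)
    then show ?thesis by blast
  qed (use S1 in blast)
  then obtain S2 where S2: "S1 \<subseteq> S2" "up_along v F S2" "v d \<longrightarrow> Pos d \<in> S2"
    by blast
  have "\<forall>u \<in> (w(i := c, j := d)) ` I. v u \<longrightarrow> Pos u \<in> S2"
    using Cons(6) S1 S2 by auto
  then obtain S3 where S3: "S2 \<subseteq> S3" "up_along v F S3"
      "\<forall>u \<in> (w(i := c, j := d)) ` I \<union> output_vars N. v u \<longrightarrow> Pos u \<in> S3"
    using Cons(1)[OF _ _ _ S2(2)] Cons(2,3,4) by (auto simp del: fun_upd_apply)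
  have "\<forall>u \<in> w ` I \<union> output_vars (Comparator i j c d # N). v u \<longrightarrow> Pos u \<in> S3"
    using Cons(6) S1 S2 S3 by auto
  moreover have "S \<subseteq> S3"
    using S1(1) S2(1) S3(1) by blast
  ultimately show ?case
    using S3(2) by blast
qed auto

text \<open>Switching on \<open>p\<close> changes one wire after each comparator, ending at
  \<open>q\<close>, and negation travels back along this path. Evaluation and propagation share the
  witness \<open>q\<close>, so a caller can identify \<open>q\<close> by evaluation before pulling
  its negation back to \<open>p\<close>.\<close>

lemma backward_propagation:
  assumes "wires_in I N" "network_model v w N" "network_cnf w N \<subseteq> F"
    and "\<forall>u \<in> w ` I \<union> output_vars N. v u \<longrightarrow> Pos u \<in> S" and "p \<in> I" "\<not> v (w p)"
  shows "\<exists>q\<in>I. network_eval ((v \<circ> w)(p := True)) N = (network_eval (v \<circ> w) N)(q := True) \<and>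
    (\<forall>S'. S \<subseteq> S' \<longrightarrow> up_along v F S' \<longrightarrow> Neg (network_outputs w N q) \<in> S' \<longrightarrow>
      (\<exists>S''. S' \<subseteq> S'' \<and> up_along v F S'' \<and> Neg (w p) \<in> S''))"
  using assms
proof (induction w N arbitrary: p rule: network_induct)
  case (Nil w)
  then show ?case by (intro bexI[of _ p]) auto
next
  case (Cons w i j c d N)
  let ?w = "w(i := c, j := d)"
  have clauses: "{Neg (w i), Pos c} \<in> F" "{Neg (w j), Pos c} \<in> F" "{Neg (w i), Neg (w j), Pos d} \<in> F"
    using Cons(4) by (auto simp: comparator_clauses_def)
  have vals: "v c = (v (w i) \<or> v (w j))" "v d = (v (w i) \<and> v (w j))"
    using Cons(3) by auto
  have ij: "i \<in> I" "j \<in> I" "i \<noteq> j"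
    using Cons(2) by auto
  have ins: "v (w i) \<Longrightarrow> Pos (w i) \<in> S" "v (w j) \<Longrightarrow> Pos (w j) \<in> S"
    using Cons(5) ij by auto
  \<comment> \<open>\<open>r\<close> is the wire that changes behind the comparator when wire \<open>p\<close> is switched on.\<close>
  define r where "r = (if p = i then if v (w j) then j else i
    else if p = j then if v (w i) then j else i else p)"
  have r: "r \<in> I" "\<not> v (?w r)"
    using ij vals Cons(6,7) by (auto simp: r_def)
  \<comment> \<open>At a comparator reading \<open>p\<close>: if the other input is true, the
    maximum is already true and the minimum flips; otherwise the maximum flips and the minimum stays
    false.\<close>
  have upd: "((v \<circ> w)(p := True))(i := ((v \<circ> w)(p := True)) i \<or> ((v \<circ> w)(p := True)) j,
      j := ((v \<circ> w)(p := True)) i \<and> ((v \<circ> w)(p := True)) j) = (v \<circ> ?w)(r := True)"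
    using ij vals Cons(7) by (auto simp: r_def fun_eq_iff)
  have upd0: "(v \<circ> w)(i := (v \<circ> w) i \<or> (v \<circ> w) j, j := (v \<circ> w) i \<and> (v \<circ> w) j) = v \<circ> ?w"
    using vals by (auto simp: fun_eq_iff)
  have pos: "\<forall>u \<in> ?w ` I \<union> output_vars N. v u \<longrightarrow> Pos u \<in> S"
    using Cons(5) by auto
  obtain q where q: "q \<in> I"
      "network_eval ((v \<circ> ?w)(r := True)) N = (network_eval (v \<circ> ?w) N)(q := True)"
      "\<And>S'. S \<subseteq> S' \<Longrightarrow> up_along v F S' \<Longrightarrow> Neg (network_outputs ?w N q) \<in> S' \<Longrightarrow>
        \<exists>S''. S' \<subseteq> S'' \<and> up_along v F S'' \<and> Neg (?w r) \<in> S''"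
    using Cons(1)[OF _ _ _ pos r] Cons(2,3,4)
    unfolding wires_in_simps network_model.simps network_cnf.simps Un_subset_iff by blast
  have pullback: "\<exists>S''. S' \<subseteq> S'' \<and> up_along v F S'' \<and> Neg (w p) \<in> S''"
    if "S \<subseteq> S'" "up_along v F S'" "Neg (?w r) \<in> S'" for S'
  proof (cases "p = i \<or> p = j")
    case True
    \<comment> \<open>Here \<open>r = j\<close> exactly when the other input is true; that input, in
      \<open>S\<close>, and \<open>Neg d\<close> then reduce the three-literal clause to
      \<open>Neg (w p)\<close>. Otherwise \<open>Neg c\<close> reduces a two-literal clause.\<close>
    have "\<exists>C\<in>F. Neg (w p) \<in> C \<and> C - {Neg (w p)} \<subseteq> compl ` S'"
    proof (cases "r = j")
      case True
      then show ?thesis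
        using that ins ij clauses(3) Cons(7) \<open>p = i \<or> p = j\<close>
        by (intro bexI[OF _ clauses(3)]) (auto simp: r_def in_compl_image_iff split: if_splits)
    next
      case False
      then have "Neg c \<in> S'"
        using that ij True by (auto simp: r_def split: if_splits)
      moreover have "{Neg (w p), Pos c} \<in> F"
        using True clauses by auto
      ultimately show ?thesis
        by (intro bexI[of _ "{Neg (w p), Pos c}"]) (auto simp: in_compl_image_iff)
    qed
    then have "up_along v F (insert (Neg (w p)) S')"
      using up_along.insert[OF that(2)] Cons(7) by auto
    then show ?thesis by blast
  next
    case False
    then show ?thesis
      using that by (auto simp: r_def)
  qed
  show ?case
  proof (intro bexI[OF _ q(1)] conjI allI impI)
    show "network_eval ((v \<circ> w)(p := True)) (Comparator i j c d # N) =
        (network_eval (v \<circ> w) (Comparator i j c d # N))(q := True)"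
      unfolding network_eval.simps max_bool min_bool upd upd0 by (rule q(2))
  next
    fix S' assume S': "S \<subseteq> S'" "up_along v F S'"
      "Neg (network_outputs w (Comparator i j c d # N) q) \<in> S'"
    then obtain S1 where S1: "S' \<subseteq> S1" "up_along v F S1" "Neg (?w r) \<in> S1"
      using q(3)[OF S'(1,2)] S'(3) unfolding network_outputs.simps by blast
    show "\<exists>S''. S' \<subseteq> S'' \<and> up_along v F S'' \<and> Neg (w p) \<in> S''"
      using pullback[OF _ S1(2,3)] S1(1) S'(1) by (meson order_trans)
  qed
qed


section \<open>Sorting Boolean inputs\<close>

text \<open>Ascending order with \<open>False < True\<close>; the \<open>rev\<close> in
  \<open>sorting_network\<close> then puts \<open>True\<close> first.\<close>

lemma sort_bool:
  "sort bs = replicate (length (filter Not bs)) False @ replicate (length (filter id bs)) True"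
proof (rule properties_for_sort)
  show "mset (replicate (length (filter Not bs)) False @ replicate (length (filter id bs)) True) = mset bs"
    by (induction bs) auto
  show "sorted (replicate (length (filter Not bs)) False @ replicate (length (filter id bs)) True)"
    by (auto simp: sorted_append)
qed

lemma sorting_network_eval:
  assumes "sorting_network n N" "i \<in> {1..n}"
  shows "network_eval b N i \<longleftrightarrow> i \<le> card {j \<in> {1..n}. b j}"
proof -
  define t f where "t = length (filter id (map b [1..<Suc n]))"
    and "f = length (filter Not (map b [1..<Suc n]))"
  have "map (network_eval b N) [1..<Suc n] = replicate t True @ replicate f False"
    using assms(1) unfolding sorting_network_def sort_bool t_def f_def by simp
  \<comment> \<open>Wires are numbered from 1, list positions from 0.\<close>
  then have eq: "map (network_eval b N) [1..<Suc n] ! (i - 1) =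
      (replicate t True @ replicate f False) ! (i - 1)"
    and "length (map (network_eval b N) [1..<Suc n]) = length (replicate t True @ replicate f False)"
    by metis+
  then have "t + f = n" by (simp del: upt_Suc)
  then have "(replicate t True @ replicate f False) ! (i - 1) \<longleftrightarrow> i \<le> t"
    using assms(2) by (auto simp: nth_append)
  moreover have "map (network_eval b N) [1..<Suc n] ! (i - 1) = network_eval b N i"
    using assms(2) by (auto simp del: upt_Suc)
  moreover have "t = card {j \<in> {1..n}. b j}"
  proof -
    have "t = length (filter b [1..<Suc n])"
      unfolding t_def filter_map length_map by (simp add: comp_def del: upt_Suc)
    also have "\<dots> = card (set (filter b [1..<Suc n]))"
      by (metis distinct_card distinct_filter distinct_upt)
    also have "set (filter b [1..<Suc n]) = {j \<in> {1..n}. b j}"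
      by auto
    finally show ?thesis .
  qed
  ultimately show ?thesis
    using eq by simp
qed


section \<open>The encoding\<close>

theorem proposition4:
  fixes n k :: nat and x z :: "nat \<Rightarrow> 'v" and y :: 'v and \<Phi> :: "'v cnf"
  assumes "1 \<le> k" and "k < n"
    and "inj_on x {1..n}"
    and "y \<notin> x ` {1..n}"
    and "SN_encoding n x \<Phi> z"
    and "y \<notin> cnf_vars \<Phi>"
  shows "preserves_GAC (\<Phi> \<union> {{Neg y, Neg (z (k + 1))}}) y n x k"
proof -
  let ?I = "{1..n}"
  let ?F = "\<Phi> \<union> {{Neg y, Neg (z (k + 1))}}"
  obtain N where N: "sorting_network n N" "fresh_outputs (x ` ?I) N" "\<Phi> = network_cnf x N"
      "\<forall>i\<in>?I. z i = network_outputs x N i"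
    using assms(5) unfolding SN_encoding_def by blast
  have wires: "wires_in ?I N"
    using N(1) unfolding sorting_network_def wires_in_def by blast
  have k1: "k + 1 \<in> ?I" and z: "z (k + 1) = network_outputs x N (k + 1)"
    using assms(2) N(4) by auto
  have y: "y \<notin> output_vars N"
    using assms(6) output_vars_subset_cnf_vars[of N x] N(3) by blast
  \<comment> \<open>Common to all three claims. With \<open>yv\<close> true, \<open>y\<close> is
    asserted and propagated; with \<open>yv\<close> false, \<open>v y\<close> is false, so
    \<open>Neg y\<close> may later be propagated along \<open>v\<close>. Inputs not asserted by
    \<rho> are false under \<open>v\<close>.\<close>
  have propagate: "\<exists>v S. network_model v x N \<and> v y = yv \<and> (\<forall>i\<in>?I. v (x i) \<longleftrightarrow> Pos (x i) \<in> \<rho>) \<and>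
      up_along v (under ?F \<sigma>) S \<and> (yv \<longrightarrow> Pos y \<in> S) \<and>
      (\<forall>u \<in> x ` ?I \<union> output_vars N. v u \<longrightarrow> Pos u \<in> S) \<and>
      (v (z (k + 1)) \<longleftrightarrow> k < num_true n x \<rho>)"
    if "\<sigma> = \<rho> \<union> (if yv then {Pos y} else {})" for \<rho> \<sigma> yv
  proof -
    obtain v where v: "network_model v x N"
        "\<And>u. u \<notin> output_vars N \<Longrightarrow> v u = (if u = y then yv else Pos u \<in> \<rho>)"
      using ex_network_model[OF wires N(2) order_refl, of "\<lambda>u. if u = y then yv else Pos u \<in> \<rho>"]
      by blast
    have vx: "v (x i) \<longleftrightarrow> Pos (x i) \<in> \<rho>" if "i \<in> ?I" for i
    proof -
      have "output_vars N \<inter> x ` ?I = {}"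
        using N(2) unfolding fresh_outputs_def output_vars_def Let_def by blast
      then have "x i \<notin> output_vars N"
        using that by blast
      moreover have "x i \<noteq> y"
        using assms(4) that by blast
      ultimately show ?thesis
        using v(2) by simp
    qed
    have vy: "v y = yv"
      using v(2) y by simp
    define T where "T = (\<lambda>i. Pos (x i)) ` {i \<in> ?I. Pos (x i) \<in> \<rho>} \<union> (if yv then {Pos y} else {})"
    have "\<forall>l\<in>T. {l} \<in> under ?F \<sigma> \<and> lit_true v l"
      using vx vy that by (auto simp: T_def under_def)
    then have T: "up_along v (under ?F \<sigma>) T"
      using up_along_units[of T v "under ?F \<sigma>" "{}"] up_along.empty[of v "under ?F \<sigma>"]
      by (simp add: T_def)
    have Tx: "\<forall>u \<in> x ` ?I. v u \<longrightarrow> Pos u \<in> T"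
      using vx by (auto simp: T_def)
    obtain S where S: "T \<subseteq> S" "up_along v (under ?F \<sigma>) S"
        "\<forall>u \<in> x ` ?I \<union> output_vars N. v u \<longrightarrow> Pos u \<in> S"
      using forward_propagation[OF wires v(1) _ T Tx] N(3) unfolding under_def by auto
    have "v (z (k + 1)) \<longleftrightarrow> network_eval (v \<circ> x) N (k + 1)"
      by (simp only: network_eval_model[OF v(1)] z comp_apply)
    also have "\<dots> \<longleftrightarrow> k + 1 \<le> card {j \<in> ?I. (v \<circ> x) j}"
      by (rule sorting_network_eval[OF N(1) k1])
    also have "{j \<in> ?I. (v \<circ> x) j} = {j \<in> ?I. Pos (x j) \<in> \<rho>}"
      using vx by auto
    finally have "v (z (k + 1)) \<longleftrightarrow> k < num_true n x \<rho>"
      by (simp add: num_true_def Suc_le_eq)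
    moreover have "yv \<longrightarrow> Pos y \<in> S"
      using S(1) by (auto simp: T_def)
    ultimately show ?thesis
      using v(1) vx vy S(2,3) by blast
  qed
  have z_in: "z (k + 1) \<in> x ` ?I \<union> output_vars N"
    unfolding z by (rule network_outputs_in[OF wires k1])
  have clause: "{Neg y, Neg (z (k + 1))} \<in> under ?F \<sigma>" for \<sigma>
    by (simp add: under_def)
  show ?thesis
    unfolding preserves_GAC_def
  proof (intro allI impI conjI ballI)
    fix \<rho> assume many: "k < num_true n x \<rho>"
    \<comment> \<open>With \<open>y\<close> and \<open>z (k + 1)\<close> both propagated, the added
      clause becomes empty.\<close>
    obtain v S where "up_along v (under ?F (\<rho> \<union> {Pos y})) S" "Pos y \<in> S" "Pos (z (k + 1)) \<in> S"
      using propagate[of "\<rho> \<union> {Pos y}" \<rho> True] many z_in by auto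
    then show "up_conflict (under ?F (\<rho> \<union> {Pos y}))"
      using clause by (intro up_along_conflict[of v _ S "{Neg y, Neg (z (k + 1))}"])
        (auto simp: in_compl_image_iff)
  next
    fix \<rho> assume many: "k < num_true n x \<rho>"
    \<comment> \<open>Without \<open>y\<close>, the literal \<open>Pos (z (k + 1))\<close> reduces
      the added clause to \<open>Neg y\<close>.\<close>
    obtain v S where S: "up_along v (under ?F \<rho>) S" "\<not> v y" "Pos (z (k + 1)) \<in> S"
      using propagate[of \<rho> \<rho> False] many z_in by auto
    then have "up_along v (under ?F \<rho>) (insert (Neg y) S)"
      using clause by (intro up_along.insert[of v _ S "{Neg y, Neg (z (k + 1))}"])
        (auto simp: in_compl_image_iff)
    then show "up_derives (under ?F \<rho>) (Neg y)"
      by (rule up_along_derives) simp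
  next
    fix \<rho> j assume exact: "num_true n x \<rho> = k" and j: "j \<in> ?I"
      and unassigned: "Pos (x j) \<notin> \<rho> \<and> Neg (x j) \<notin> \<rho>"
    let ?G = "under ?F (\<rho> \<union> {Pos y})"
    obtain v S where v: "network_model v x N" "\<forall>i\<in>?I. v (x i) \<longleftrightarrow> Pos (x i) \<in> \<rho>"
        "\<not> v (z (k + 1))"
      and S: "up_along v ?G S" "Pos y \<in> S" "\<forall>u \<in> x ` ?I \<union> output_vars N. v u \<longrightarrow> Pos u \<in> S"
      using propagate[of "\<rho> \<union> {Pos y}" \<rho> True] exact by auto
    have "network_cnf x N \<subseteq> ?G" "\<not> v (x j)"
      using N(3) v(2) j unassigned by (auto simp: under_def)
    then obtain q where
        q: "network_eval ((v \<circ> x)(j := True)) N = (network_eval (v \<circ> x) N)(q := True)"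
      and pullback: "\<And>S'. S \<subseteq> S' \<Longrightarrow> up_along v ?G S' \<Longrightarrow> Neg (network_outputs x N q) \<in> S' \<Longrightarrow>
          \<exists>S''. S' \<subseteq> S'' \<and> up_along v ?G S'' \<and> Neg (x j) \<in> S''"
      using backward_propagation[OF wires v(1) _ S(3) j] by metis
    \<comment> \<open>As \<open>x j\<close> is unassigned, \<open>j\<close> is not among the
      \<open>k\<close> true inputs, so switching it on makes \<open>k + 1\<close> of them.\<close>
    have "{i \<in> ?I. ((v \<circ> x)(j := True)) i} = insert j {i \<in> ?I. Pos (x i) \<in> \<rho>}"
      using v(2) j by auto
    then have "card {i \<in> ?I. ((v \<circ> x)(j := True)) i} = k + 1"
      using exact unassigned by (simp add: num_true_def)
    then have "network_eval ((v \<circ> x)(j := True)) N (k + 1)"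
      using sorting_network_eval[OF N(1) k1] by simp
    moreover have "\<not> network_eval (v \<circ> x) N (k + 1)"
      using v(3) unfolding network_eval_model[OF v(1)] z by simp
    \<comment> \<open>Output \<open>k + 1\<close> changes from false to true, and no output other
      than \<open>q\<close> changes.\<close>
    ultimately have "q = k + 1"
      unfolding q by (metis fun_upd_other)
    \<comment> \<open>Since \<open>y\<close> is propagated, the added clause yields
      \<open>Neg (z (k + 1))\<close>, where backward propagation starts.\<close>
    have "up_along v ?G (insert (Neg (z (k + 1))) S)"
      using clause S v(3) by (intro up_along.insert[of v _ S "{Neg y, Neg (z (k + 1))}"])
        (auto simp: in_compl_image_iff)
    then obtain S'' where "up_along v ?G S''" "Neg (x j) \<in> S''"
      using pullback[of "insert (Neg (z (k + 1))) S"] \<open>q = k + 1\<close> z by auto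
    then show "up_derives ?G (Neg (x j))"
      by (rule up_along_derives)
  qed
qed

end
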